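(* A fault tolerant reversible full adder circuit can be realized using only two IG gates, with three garbage outputs and two constant inputs. That is, there is a reversible circuit on five lines consisting of exactly two IG gates, whose input lines carry $A$, $B$, $C_{in}$ and two fixed constants in $\{0,1\}$, such that for all $A,B,C_{in}\in\{0,1\}$ one output line carries $S=A\oplus B\oplus C_{in}$, another output line carries $C_{out}=(A\oplus B)C_{in}\oplus AB$, and the remaining three output lines are garbage outputs; moreover the circuit is parity preserving (the EX-OR of all five inputs equals the EX-OR of all five outputs).
   Context: $\oplus$ denotes addition modulo 2 (EX-OR) and juxtaposition denotes AND on $\{0,1\}$. The 4*4 gate $\mathrm{IG}:\{0,1\}^4\to\{0,1\}^4$ maps an input $(A,B,C,D)$ to an output $(P,Q,R,S)$ as follows (tuples written as bit strings $ABCD\mapsto PQRS$). If $A=0$: $0BCD\mapsto 0BCD$ for all $B,C,D\in\{0,1\}$. If $A=1$: $1000\mapsto1101$, $1001\mapsto1100$, $1010\mapsto1111$, $1011\mapsto1110$, $1100\mapsto1010$, $1101\mapsto1011$, $1110\mapsto1000$, $1111\mapsto1001$. A reversible circuit of IG gates on $k$ lines is a finite sequence of IG gates, each applied to an ordered 4-tuple of distinct lines among the $k$ lines, replacing the four values on those lines by the four output values of the gate (so the circuit is acyclic and has no fan-out). An input line set to a fixed value in $\{0,1\}$ is a constant input. An output line of the circuit not used as a primary output (here, not used as $S$ or $C_{out}$) is a garbage output. A reversible circuit is fault tolerant if it is parity preserving: the EX-OR of its inputs always equals the EX-OR of its outputs. *)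

theory Defs
  imports Main "HOL-Library.Z2"
begin

text \<open>
  Bits are elements of the two-element field \<^typ>\<open>bit\<close>, so \<open>+\<close> is EX-OR and \<open>*\<close> is AND.
\<close>

definition IG :: "bit \<times> bit \<times> bit \<times> bit \<Rightarrow> bit \<times> bit \<times> bit \<times> bit" where
  "IG x =
    (if fst x = 0 then x
     else if x = (1,0,0,0) then (1,1,0,1)
     else if x = (1,0,0,1) then (1,1,0,0)
     else if x = (1,0,1,0) then (1,1,1,1)
     else if x = (1,0,1,1) then (1,1,1,0)
     else if x = (1,1,0,0) then (1,0,1,0)
     else if x = (1,1,0,1) then (1,0,1,1)
     else if x = (1,1,1,0) then (1,0,0,0)
     else (1,0,0,1))"

text \<open>
  The values on \<open>k\<close> lines form a list of length \<open>k\<close>, lines being numbered from \<open>0\<close>.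
  A gate is given by the ordered 4-tuple of lines it acts on, a circuit by the list of its gates
  in order of application.
\<close>

type_synonym gate = "nat \<times> nat \<times> nat \<times> nat"

definition IG_circuit :: "nat \<Rightarrow> gate list \<Rightarrow> bool" where
  "IG_circuit k gs \<longleftrightarrow>
    (\<forall>(a, b, c, d) \<in> set gs. distinct [a, b, c, d] \<and> {a, b, c, d} \<subseteq> {..<k})"

definition apply_gate :: "gate \<Rightarrow> bit list \<Rightarrow> bit list" where
  "apply_gate g x =
    (case g of (a, b, c, d) \<Rightarrow>
      (case IG (x ! a, x ! b, x ! c, x ! d) of (p, q, r, s) \<Rightarrow>
        x[a := p, b := q, c := r, d := s]))"

definition run_circuit :: "gate list \<Rightarrow> bit list \<Rightarrow> bit list" where
  "run_circuit gs x = fold apply_gate gs x"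

definition parity_preserving :: "nat \<Rightarrow> gate list \<Rightarrow> bool" where
  "parity_preserving k gs \<longleftrightarrow>
    (\<forall>x. length x = k \<longrightarrow> sum_list (run_circuit gs x) = sum_list x)"

datatype input_line = Input_A | Input_B | Input_Cin | Constant bit

fun input_value :: "bit \<Rightarrow> bit \<Rightarrow> bit \<Rightarrow> input_line \<Rightarrow> bit" where
  "input_value A B Cin Input_A = A"
| "input_value A B Cin Input_B = B"
| "input_value A B Cin Input_Cin = Cin"
| "input_value A B Cin (Constant v) = v"

definition constant_inputs :: "input_line list \<Rightarrow> nat set" where
  "constant_inputs ins = {i. i < length ins \<and> (\<exists>v. ins ! i = Constant v)}"

text \<open>
  There is no fan-out, so each of the three inputs is fed to exactly one line.
  The output lines \<open>s\<close> and \<open>c\<close> are those of the sum and of the carry.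
\<close>

definition realizes_full_adder ::
  "nat \<Rightarrow> gate list \<Rightarrow> input_line list \<Rightarrow> nat \<Rightarrow> nat \<Rightarrow> bool" where
  "realizes_full_adder k gs ins s c \<longleftrightarrow>
    IG_circuit k gs \<and> length ins = k \<and>
    count_list ins Input_A = 1 \<and> count_list ins Input_B = 1 \<and> count_list ins Input_Cin = 1 \<and>
    s < k \<and> c < k \<and> s \<noteq> c \<and>
    (\<forall>A B Cin. let out = run_circuit gs (map (input_value A B Cin) ins) in
      out ! s = A + B + Cin \<and> out ! c = (A + B) * Cin + A * B)"

definition garbage_outputs :: "nat \<Rightarrow> nat \<Rightarrow> nat \<Rightarrow> nat set" where
  "garbage_outputs k s c = {..<k} - {s, c}"

end

(*
  In algebraic normal form IG is (a, b, c, d) |-> (a, a + b, ab + c, a + ab + d). Feeding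
  (A, B, 0, 0) to a first gate gives A + B and AB on its second and third lines. A second gate with
  control A + B, acting on Cin and on AB, turns these into A + B + Cin and (A + B) Cin + AB.
  The four components of the normal form add up to a + b + c + d, so every IG circuit preserves
  parity.
*)
theory Submission
  imports Defs
begin

lemma IG_eq: "IG (a, b, c, d) = (a, a + b, a * b + c, a + a * b + d)"
  by (cases a; cases b; cases c; cases d) (simp_all add: IG_def)

lemma apply_gate_eq:
  "apply_gate (a, b, c, d) x =
    x[a := x ! a, b := x ! a + x ! b, c := x ! a * x ! b + x ! c,
      d := x ! a + x ! a * x ! b + x ! d]"
  by (simp add: apply_gate_def IG_eq)

text \<open>Subtraction cancels the overwritten entry, so the four updates of a gate can be
  accounted for one at a time.\<close>

lemma sum_list_update_group:
  fixes x :: "'a::ab_group_add list"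
  assumes "i < length x"
  shows "sum_list (x[i := v]) = sum_list x - x ! i + v"
  using assms
proof (induction x arbitrary: i)
  case (Cons y ys)
  then show ?case
    by (cases i) (simp_all add: algebra_simps)
qed simp

text \<open>Since the lines are distinct, no update overwrites an entry that a later one replaces.
  The sum thus changes only by the new minus the old values on four lines, which is zero for each of
  the 16 bit patterns.\<close>

lemma sum_list_apply_gate:
  assumes "distinct [a, b, c, d]" "{a, b, c, d} \<subseteq> {..<length x}"
  shows "sum_list (apply_gate (a, b, c, d) x) = sum_list x"
  using assms
  by (cases "x ! a"; cases "x ! b"; cases "x ! c"; cases "x ! d")
    (simp_all add: apply_gate_eq sum_list_update_group)

lemma length_apply_gate [simp]: "length (apply_gate g x) = length x"
  by (cases g) (simp add: apply_gate_eq)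

lemma IG_circuit_parity_preserving:
  assumes "IG_circuit k gs"
  shows "parity_preserving k gs"
proof -
  have "sum_list (fold apply_gate gs x) = sum_list x" if "length x = k" for x
    using assms that
  proof (induction gs arbitrary: x)
    case (Cons g gs)
    obtain a b c d where g: "g = (a, b, c, d)"
      by (cases g) auto
    have "sum_list (apply_gate g x) = sum_list x"
      unfolding g using Cons.prems by (intro sum_list_apply_gate) (auto simp: IG_circuit_def g)
    then show ?case
      using Cons by (simp add: IG_circuit_def)
  qed simp
  then show ?thesis
    by (simp add: parity_preserving_def run_circuit_def)
qed

theorem mainTheorem2:
  shows "\<exists>(gs :: gate list) (ins :: input_line list) (s :: nat) (c :: nat).
    length gs = 2 \<and>
    realizes_full_adder 5 gs ins s c \<and>
    card (garbage_outputs 5 s c) = 3 \<and>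
    card (constant_inputs ins) = 2 \<and>
    parity_preserving 5 gs"
proof -
  define gs :: "gate list" where "gs = [(0, 1, 2, 3), (1, 4, 2, 3)]"
  define ins where "ins = [Input_A, Input_B, Constant 0, Constant 0, Input_Cin]"
  have circuit: "IG_circuit 5 gs"
    by (simp add: IG_circuit_def gs_def)
  have "realizes_full_adder 5 gs ins 4 2"
    using circuit
    \<comment> \<open>\<open>numeral_eq_Suc\<close> makes the line numbers successors, so that
      lookups and updates evaluate on the explicit list.\<close>
    by (simp add: realizes_full_adder_def run_circuit_def apply_gate_eq gs_def ins_def
        numeral_eq_Suc)
  moreover have "garbage_outputs 5 4 2 = {0, 1, 3}"
    by (auto simp: garbage_outputs_def)
  then have "card (garbage_outputs 5 4 2) = 3"
    by simp
  moreover have "constant_inputs ins = {2, 3}"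
    by (auto simp: constant_inputs_def ins_def less_Suc_eq numeral_eq_Suc)
  then have "card (constant_inputs ins) = 2"
    by simp
  moreover have "length gs = 2"
    by (simp add: gs_def)
  ultimately show ?thesis
    using IG_circuit_parity_preserving[OF circuit] by blast
qed

end
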